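(* Over intuitionistic logic (arithmetic), the principles DNS$^{\mathrm{V}}$ and MP together imply EnDec. Here DNS$^{\mathrm{V}}$ is the schema $\neg\neg\forall n\,(A(n)\vee\neg A(n))$ for every formula $A(n)$; MP is the schema $\neg\neg S\to S$ for every $\Sigma$-formula $S$; and EnDec is the statement: for every enumerable set $B\subseteq\mathbb{N}$, if for every decidable $C\subseteq B$ we have that $\exists m\,(m\notin C)$ implies $\exists m\,(m\notin C\wedge m\in B)$, then $\mathbb{N}\subseteq B$.
   Context: A $\Sigma$-formula is one built only from existential quantifiers over $\mathbb{N}$, disjunction, conjunction and equality of natural numbers. A set $B\subseteq\mathbb{N}$ is enumerable if membership $n\in B$ is given by a $\Sigma$-formula; a set $C\subseteq\mathbb{N}$ is decidable if $\forall n(n\in C\vee n\notin C)$. $n\notin C$ abbreviates $\neg(n\in C)$. *)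

theory Defs
  imports Main
begin

text \<open>
  Intuitionistic arithmetic with variables for numbers and for subsets of \<open>\<nat>\<close>, as a
  natural-deduction calculus. The hypothesis of EnDec quantifies over all decidable sets inside
  an implication, so set variables are part of the object language. Both sorts of variables are
  de Bruijn indices, counted separately.
\<close>

datatype tm = Var nat | Zero | Succ tm | Plus tm tm | Times tm tm

datatype fm =
    Eq tm tm
  | Mem tm nat
  | Bot
  | And fm fm
  | Or fm fm
  | Imp fm fm
  | All fm
  | Ex fm
  | AllS fm
  | ExS fm

abbreviation Neg :: "fm \<Rightarrow> fm" where
  "Neg A \<equiv> Imp A Bot"

abbreviation Iff :: "fm \<Rightarrow> fm \<Rightarrow> fm" where
  "Iff A B \<equiv> And (Imp A B) (Imp B A)"

primrec tsubst :: "(nat \<Rightarrow> tm) \<Rightarrow> tm \<Rightarrow> tm" where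
  "tsubst \<sigma> (Var i) = \<sigma> i"
| "tsubst \<sigma> Zero = Zero"
| "tsubst \<sigma> (Succ t) = Succ (tsubst \<sigma> t)"
| "tsubst \<sigma> (Plus t u) = Plus (tsubst \<sigma> t) (tsubst \<sigma> u)"
| "tsubst \<sigma> (Times t u) = Times (tsubst \<sigma> t) (tsubst \<sigma> u)"

definition up :: "(nat \<Rightarrow> tm) \<Rightarrow> nat \<Rightarrow> tm" where
  "up \<sigma> = case_nat (Var 0) (\<lambda>i. tsubst (\<lambda>j. Var (Suc j)) (\<sigma> i))"

primrec subst :: "(nat \<Rightarrow> tm) \<Rightarrow> fm \<Rightarrow> fm" where
  "subst \<sigma> (Eq t u) = Eq (tsubst \<sigma> t) (tsubst \<sigma> u)"
| "subst \<sigma> (Mem t k) = Mem (tsubst \<sigma> t) k"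
| "subst \<sigma> Bot = Bot"
| "subst \<sigma> (And A B) = And (subst \<sigma> A) (subst \<sigma> B)"
| "subst \<sigma> (Or A B) = Or (subst \<sigma> A) (subst \<sigma> B)"
| "subst \<sigma> (Imp A B) = Imp (subst \<sigma> A) (subst \<sigma> B)"
| "subst \<sigma> (All A) = All (subst (up \<sigma>) A)"
| "subst \<sigma> (Ex A) = Ex (subst (up \<sigma>) A)"
| "subst \<sigma> (AllS A) = AllS (subst \<sigma> A)"
| "subst \<sigma> (ExS A) = ExS (subst \<sigma> A)"

text \<open>The only terms of the second sort are variables, so a substitution for them is a renaming.\<close>

definition upS :: "(nat \<Rightarrow> nat) \<Rightarrow> nat \<Rightarrow> nat" where
  "upS \<rho> = case_nat 0 (\<lambda>k. Suc (\<rho> k))"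

primrec substS :: "(nat \<Rightarrow> nat) \<Rightarrow> fm \<Rightarrow> fm" where
  "substS \<rho> (Eq t u) = Eq t u"
| "substS \<rho> (Mem t k) = Mem t (\<rho> k)"
| "substS \<rho> Bot = Bot"
| "substS \<rho> (And A B) = And (substS \<rho> A) (substS \<rho> B)"
| "substS \<rho> (Or A B) = Or (substS \<rho> A) (substS \<rho> B)"
| "substS \<rho> (Imp A B) = Imp (substS \<rho> A) (substS \<rho> B)"
| "substS \<rho> (All A) = All (substS \<rho> A)"
| "substS \<rho> (Ex A) = Ex (substS \<rho> A)"
| "substS \<rho> (AllS A) = AllS (substS (upS \<rho>) A)"
| "substS \<rho> (ExS A) = ExS (substS (upS \<rho>) A)"

abbreviation lift :: "fm \<Rightarrow> fm" where
  "lift \<equiv> subst (\<lambda>i. Var (Suc i))"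

abbreviation inst :: "tm \<Rightarrow> fm \<Rightarrow> fm" where
  "inst t \<equiv> subst (case_nat t Var)"

abbreviation liftS :: "fm \<Rightarrow> fm" where
  "liftS \<equiv> substS Suc"

abbreviation instS :: "nat \<Rightarrow> fm \<Rightarrow> fm" where
  "instS k \<equiv> substS (case_nat k (\<lambda>i. i))"

text \<open>
  \<open>proves T \<Gamma> A\<close>: intuitionistic derivability of \<open>A\<close> from the hypotheses \<open>\<Gamma>\<close> and the axioms \<open>T\<close>.
  Free variables are parameters in \<open>\<Gamma>\<close> but are read universally in \<open>T\<close>: the quantifier
  rules shift \<open>\<Gamma>\<close> and leave \<open>T\<close> alone.
\<close>

inductive proves :: "fm set \<Rightarrow> fm set \<Rightarrow> fm \<Rightarrow> bool" for T :: "fm set" where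
  axiom: "A \<in> T \<Longrightarrow> proves T \<Gamma> A"
| hyp: "A \<in> \<Gamma> \<Longrightarrow> proves T \<Gamma> A"
| BotE: "proves T \<Gamma> Bot \<Longrightarrow> proves T \<Gamma> A"
| AndI: "proves T \<Gamma> A \<Longrightarrow> proves T \<Gamma> B \<Longrightarrow> proves T \<Gamma> (And A B)"
| AndE1: "proves T \<Gamma> (And A B) \<Longrightarrow> proves T \<Gamma> A"
| AndE2: "proves T \<Gamma> (And A B) \<Longrightarrow> proves T \<Gamma> B"
| OrI1: "proves T \<Gamma> A \<Longrightarrow> proves T \<Gamma> (Or A B)"
| OrI2: "proves T \<Gamma> B \<Longrightarrow> proves T \<Gamma> (Or A B)"
| OrE: "proves T \<Gamma> (Or A B) \<Longrightarrow> proves T (insert A \<Gamma>) C \<Longrightarrow> proves T (insert B \<Gamma>) C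
    \<Longrightarrow> proves T \<Gamma> C"
| ImpI: "proves T (insert A \<Gamma>) B \<Longrightarrow> proves T \<Gamma> (Imp A B)"
| ImpE: "proves T \<Gamma> (Imp A B) \<Longrightarrow> proves T \<Gamma> A \<Longrightarrow> proves T \<Gamma> B"
| AllI: "proves T (lift ` \<Gamma>) A \<Longrightarrow> proves T \<Gamma> (All A)"
| AllE: "proves T \<Gamma> (All A) \<Longrightarrow> proves T \<Gamma> (inst t A)"
| ExI: "proves T \<Gamma> (inst t A) \<Longrightarrow> proves T \<Gamma> (Ex A)"
| ExE: "proves T \<Gamma> (Ex A) \<Longrightarrow> proves T (insert A (lift ` \<Gamma>)) (lift C) \<Longrightarrow> proves T \<Gamma> C"
| AllSI: "proves T (liftS ` \<Gamma>) A \<Longrightarrow> proves T \<Gamma> (AllS A)"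
| AllSE: "proves T \<Gamma> (AllS A) \<Longrightarrow> proves T \<Gamma> (instS k A)"
| ExSI: "proves T \<Gamma> (instS k A) \<Longrightarrow> proves T \<Gamma> (ExS A)"
| ExSE: "proves T \<Gamma> (ExS A) \<Longrightarrow> proves T (insert A (liftS ` \<Gamma>)) (liftS C) \<Longrightarrow> proves T \<Gamma> C"

primrec arithmetical :: "fm \<Rightarrow> bool" where
  "arithmetical (Eq t u) \<longleftrightarrow> True"
| "arithmetical (Mem t k) \<longleftrightarrow> True"
| "arithmetical Bot \<longleftrightarrow> True"
| "arithmetical (And A B) \<longleftrightarrow> arithmetical A \<and> arithmetical B"
| "arithmetical (Or A B) \<longleftrightarrow> arithmetical A \<and> arithmetical B"
| "arithmetical (Imp A B) \<longleftrightarrow> arithmetical A \<and> arithmetical B"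
| "arithmetical (All A) \<longleftrightarrow> arithmetical A"
| "arithmetical (Ex A) \<longleftrightarrow> arithmetical A"
| "arithmetical (AllS A) \<longleftrightarrow> False"
| "arithmetical (ExS A) \<longleftrightarrow> False"

text \<open>
  In \<open>induction\<close>, \<open>comprehension\<close> and all definitions below, a formula \<open>A(n)\<close> is a formula whose
  number variable \<open>0\<close> is \<open>n\<close>, and the other free variables are parameters. In \<open>induction\<close> the
  substitution turns \<open>A(n)\<close> into \<open>A(n + 1)\<close>. Comprehension, which says that formulas
  determine sets, is restricted to formulas without set quantifiers (set parameters are allowed);
  derivability is monotone in the axioms, so results also hold under full comprehension.
\<close>

inductive_set arithmetic :: "fm set" where
  eq_refl: "Eq t t \<in> arithmetic"
| eq_subst: "Imp (Eq t u) (Imp (inst t A) (inst u A)) \<in> arithmetic"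
| Succ_not_Zero: "Neg (Eq (Succ t) Zero) \<in> arithmetic"
| Succ_inject: "Imp (Eq (Succ t) (Succ u)) (Eq t u) \<in> arithmetic"
| Plus_Zero: "Eq (Plus t Zero) t \<in> arithmetic"
| Plus_Succ: "Eq (Plus t (Succ u)) (Succ (Plus t u)) \<in> arithmetic"
| Times_Zero: "Eq (Times t Zero) Zero \<in> arithmetic"
| Times_Succ: "Eq (Times t (Succ u)) (Plus (Times t u) t) \<in> arithmetic"
| induction: "Imp (inst Zero A)
    (Imp (All (Imp A (subst (case_nat (Succ (Var 0)) (\<lambda>i. Var (Suc i))) A))) (All A))
      \<in> arithmetic"
| comprehension: "arithmetical A \<Longrightarrow> ExS (All (Iff (Mem (Var 0) 0) (liftS A))) \<in> arithmetic"

inductive sigma :: "fm \<Rightarrow> bool" where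
  "sigma (Eq t u)"
| "sigma A \<Longrightarrow> sigma B \<Longrightarrow> sigma (And A B)"
| "sigma A \<Longrightarrow> sigma B \<Longrightarrow> sigma (Or A B)"
| "sigma A \<Longrightarrow> sigma (Ex A)"

definition DNSV :: "fm set" where
  "DNSV = {Neg (Neg (All (Or A (Neg A)))) | A. True}"

definition MP :: "fm set" where
  "MP = {Imp (Neg (Neg S)) S | S. sigma S}"

definition decidable :: "fm \<Rightarrow> fm" where
  "decidable C = All (Or C (Neg C))"

definition contained :: "fm \<Rightarrow> fm \<Rightarrow> fm" where
  "contained C B = All (Imp C B)"

text \<open>
  The enumerable set \<open>B\<close> is given by a \<open>\<Sigma>\<close>-formula. Below \<open>AllS\<close>, set variable \<open>0\<close> is
  \<open>C\<close>, so \<open>Mem (Var 0) 0\<close> is \<open>m \<in> C\<close>, and \<open>liftS\<close> avoids capture in \<open>B\<close>.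
\<close>

definition EnDec_for :: "fm \<Rightarrow> fm" where
  "EnDec_for B =
    Imp
      (AllS
        (Imp (And (decidable (Mem (Var 0) 0)) (contained (Mem (Var 0) 0) (liftS B)))
          (Imp (Ex (Neg (Mem (Var 0) 0)))
            (Ex (And (Neg (Mem (Var 0) 0)) (liftS B))))))
      (All B)"

definition EnDec :: "fm set" where
  "EnDec = {EnDec_for B | B. sigma B}"

end

theory Submission imports Defs begin

text \<open>
  Fix \<open>n\<close>. As \<open>B(n)\<close> is a \<open>\<Sigma>\<close>-formula, MP reduces the goal to refuting \<open>\<not> B(n)\<close>. A contradiction
  is now being derived, so DNS\<open>\<^sup>V\<close> allows the assumption that \<open>B\<close> is decidable, and the hypothesis of EnDec
  applies to \<open>C = B\<close> itself: as \<open>n \<notin> B\<close>, it yields some \<open>m\<close> with \<open>m \<notin> B\<close> and \<open>m \<in> B\<close>.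
\<close>

lemma tsubst_tsubst: "tsubst \<sigma> (tsubst \<tau> t) = tsubst (\<lambda>i. tsubst \<sigma> (\<tau> i)) t"
  by (induction t) simp_all

lemma tsubst_Var: "tsubst Var t = t"
  by (induction t) simp_all

lemma up_Var: "up Var = Var"
  by (auto simp: up_def fun_eq_iff split: nat.split)

lemma tsubst_up: "(\<lambda>i. tsubst (up \<sigma>) (up \<tau> i)) = up (\<lambda>i. tsubst \<sigma> (\<tau> i))"
  by (auto simp: up_def fun_eq_iff tsubst_tsubst split: nat.split)

lemma subst_subst: "subst \<sigma> (subst \<tau> A) = subst (\<lambda>i. tsubst \<sigma> (\<tau> i)) A"
  by (induction A arbitrary: \<sigma> \<tau>) (simp_all add: tsubst_tsubst tsubst_up)

lemma subst_Var: "subst Var A = A"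
  by (induction A) (simp_all add: tsubst_Var up_Var)

text \<open>The two substitutions cancel: each parameter goes up by one and back down, and the bound
  variable becomes \<open>Var 0\<close>.\<close>

lemma inst_Var_lift_params: "inst (Var 0) (subst (up (\<lambda>i. Var (Suc i))) A) = A"
proof -
  have "(\<lambda>i. tsubst (case_nat (Var 0) Var) (up (\<lambda>i. Var (Suc i)) i)) = Var"
    by (auto simp: up_def fun_eq_iff split: nat.split)
  then show ?thesis
    by (simp add: subst_subst subst_Var)
qed

lemma sigma_subst: "sigma A \<Longrightarrow> sigma (subst \<sigma> A)"
  by (induction arbitrary: \<sigma> rule: sigma.induct) (auto intro: sigma.intros)

text \<open>A \<Sigma>-formula has neither \<open>Mem\<close> atoms nor set quantifiers, so there is
  nothing to rename.\<close>

lemma sigma_substS: "sigma A \<Longrightarrow> substS \<rho> A = A"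
  by (induction rule: sigma.induct) auto

lemma sigma_arithmetical: "sigma A \<Longrightarrow> arithmetical A"
  by (induction rule: sigma.induct) auto

text \<open>Instantiates a shifted universal formula at the eigenvariable for which the shift made
  room.\<close>

lemma AllE_Var:
  assumes "proves T \<Gamma> (All (subst (up (\<lambda>i. Var (Suc i))) A))"
  shows "proves T \<Gamma> A"
  using AllE[OF assms, of "Var 0"] by (simp only: inst_Var_lift_params)

text \<open>
  Here the free number variable \<open>0\<close> is the fixed \<open>n\<close>: thus \<open>B\<close> reads \<open>B(n)\<close>, while \<open>B'\<close>, always used under
  one more quantifier, reads \<open>B(m)\<close> with the parameters shifted past \<open>n\<close>.
\<close>

lemma EnDec_hypothesis_refutes:
  fixes B :: fm
  defines "B' \<equiv> subst (up (\<lambda>i. Var (Suc i))) B"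
  defines "c \<equiv> Mem (Var 0) 0"
  assumes dec: "decidable B' \<in> \<Gamma>"
    and notB: "Neg B \<in> \<Gamma>"
    and C: "All (Iff c B') \<in> \<Gamma>"
    and H: "Imp (And (decidable c) (contained c B')) (Imp (Ex (Neg c)) (Ex (And (Neg c) B'))) \<in> \<Gamma>"
  shows "proves T \<Gamma> Bot"
proof -
  \<comment> \<open>Lifting \<open>\<Gamma>\<close> for a new eigenvariable \<open>m\<close> turns
    \<open>B'\<close> under a quantifier into \<open>B''\<close>.\<close>
  define B'' where "B'' = subst (up (\<lambda>i. Var (Suc i))) B'"
  have lift_c: "subst (up (\<lambda>i. Var (Suc i))) c = c" "inst (Var 0) c = c"
    by (simp_all add: c_def up_def)
  have lift_C: "lift (All (Iff c B')) = All (Iff c B'')"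
    by (simp add: B''_def lift_c)
  have lift_dec: "lift (decidable B') = decidable B''"
    by (simp add: B''_def decidable_def)
  have iff: "proves T \<Delta> (Iff c B')" if "All (Iff c B'') \<in> \<Delta>" for \<Delta>
    by (rule AllE_Var, rule hyp) (use that in \<open>simp add: B''_def lift_c\<close>)
  have inC: "All (Iff c B'') \<in> lift ` \<Gamma>"
    using C lift_C by (metis imageI)
  have lem: "proves T (lift ` \<Gamma>) (Or B' (Neg B'))"
    by (rule AllE_Var, rule hyp)
      (use dec lift_dec in \<open>auto simp: decidable_def B''_def intro: rev_image_eqI\<close>)
  \<comment> \<open>Decidability passes from \<open>B\<close> to \<open>C\<close> along their
    equivalence at \<open>m\<close>.\<close>
  have "proves T (lift ` \<Gamma>) (Or c (Neg c))"
  proof (rule OrE[OF lem])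
    show "proves T (insert B' (lift ` \<Gamma>)) (Or c (Neg c))"
      by (rule OrI1, rule ImpE, rule AndE2, rule iff) (auto intro: inC hyp)
    have "proves T (insert c (insert (Neg B') (lift ` \<Gamma>))) B'"
      by (rule ImpE, rule AndE1, rule iff) (auto intro: inC hyp)
    then show "proves T (insert (Neg B') (lift ` \<Gamma>)) (Or c (Neg c))"
      by (intro OrI2 ImpI) (rule ImpE[of _ _ B'], auto intro: hyp)
  qed
  then have "proves T \<Gamma> (decidable c)"
    unfolding decidable_def by (rule AllI)
  moreover have "proves T \<Gamma> (contained c B')"
    unfolding contained_def using iff[OF inC] by (intro AllI) (rule AndE1)
  ultimately have H': "proves T \<Gamma> (Imp (Ex (Neg c)) (Ex (And (Neg c) B')))"
    using H by (meson AndI ImpE hyp)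
  \<comment> \<open>In the unlifted context, variable \<open>0\<close> is \<open>n\<close>, so this
    is the equivalence at \<open>n\<close>.\<close>
  have "proves T \<Delta> (Iff c B)" if "All (Iff c B') \<in> \<Delta>" for \<Delta>
    by (rule AllE_Var, rule hyp) (use that in \<open>simp add: B'_def lift_c\<close>)
  then have "proves T (insert c \<Gamma>) (Iff c B)"
    using C by simp
  then have "proves T (insert c \<Gamma>) B"
    by (rule ImpE[OF AndE1]) (simp add: hyp)
  then have "proves T \<Gamma> (Neg c)"
    using notB by (intro ImpI) (rule ImpE[of _ _ B], auto intro: hyp)
  \<comment> \<open>The witness for an element outside \<open>C\<close> is \<open>n\<close>
    itself.\<close>
  then have "proves T \<Gamma> (inst (Var 0) (Neg c))"
    by (simp add: lift_c)
  then have ex: "proves T \<Gamma> (Ex (And (Neg c) B'))"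
    using H' by (meson ExI ImpE)
  let ?\<Delta> = "insert (And (Neg c) B') (lift ` \<Gamma>)"
  have m: "proves T ?\<Delta> (And (Neg c) B')"
    by (simp add: hyp)
  have "proves T ?\<Delta> (Iff c B')"
    by (rule iff) (simp add: inC)
  then have "proves T ?\<Delta> Bot"
    using m by (meson AndE1 AndE2 ImpE)
  then show ?thesis
    by (intro ExE[OF ex]) simp
qed

lemma proves_EnDec_for:
  assumes "sigma B"
    and arith: "arithmetic \<subseteq> T" and DNSV: "DNSV \<subseteq> T" and MP: "MP \<subseteq> T"
  shows "proves T {} (EnDec_for B)"
proof -
  define B' where "B' = subst (up (\<lambda>i. Var (Suc i))) B"
  let ?c = "Mem (Var 0) 0"
  let ?H = "\<lambda>A. Imp (And (decidable ?c) (contained ?c A)) (Imp (Ex (Neg ?c)) (Ex (And (Neg ?c) A)))"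
  have sigma': "sigma B'"
    unfolding B'_def by (rule sigma_subst) fact
  note [simp] = sigma_substS[OF sigma'] sigma_substS[OF \<open>sigma B\<close>]
  \<comment> \<open>Only set variable \<open>0\<close> is free in \<open>?H B'\<close>, as
    \<open>B'\<close> has none.\<close>
  have substS_H: "substS \<rho> (?H B') = ?H B'" if "\<rho> 0 = 0" for \<rho>
    using that by (simp add: decidable_def contained_def)
  have lift_H: "lift (AllS (?H B)) = AllS (?H B')"
    by (simp add: decidable_def contained_def B'_def up_def)
  have substS_B: "substS \<rho> (Neg B) = Neg B" "substS \<rho> (decidable B') = decidable B'" for \<rho>
    by (simp_all add: decidable_def)
  let ?\<Gamma> = "{decidable B', Neg B, AllS (?H B')}"
  let ?\<Delta> = "insert (All (Iff ?c B')) (liftS ` ?\<Gamma>)"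
  \<comment> \<open>The hypothesis of EnDec ranges over set variables, so the formula
    \<open>B\<close> must first be turned into a set.\<close>
  have comp: "proves T ?\<Gamma> (ExS (All (Iff ?c (liftS B'))))"
    using arith arithmetic.comprehension[OF sigma_arithmetical[OF sigma']]
    by (intro axiom) blast
  have "liftS (AllS (?H B')) = AllS (?H B')"
    using substS_H[of "upS Suc"] by (simp add: upS_def)
  then have "proves T ?\<Delta> (AllS (?H B'))"
    by (intro hyp) (metis imageI insertCI)
  \<comment> \<open>Set variable \<open>0\<close> is now the set given by comprehension.\<close>
  from AllSE[OF this, of 0] have "proves T ?\<Delta> (?H B')"
    by (simp only: substS_H nat.case)
  moreover have "proves T (insert (?H B') ?\<Delta>) Bot"
    unfolding B'_def
    by (rule EnDec_hypothesis_refutes[of B]) (simp_all add: substS_B[unfolded B'_def] del: substS.simps)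
  ultimately have "proves T ?\<Delta> (liftS Bot)"
    by (metis ImpE ImpI substS.simps(3))
  then have "proves T ?\<Gamma> Bot"
    by (intro ExSE[OF comp]) simp
  then have "proves T {Neg B, AllS (?H B')} (Neg (decidable B'))"
    by (rule ImpI)
  \<comment> \<open>This is the instance of \<open>DNSV\<close> at \<open>B'\<close>.\<close>
  moreover have "proves T {Neg B, AllS (?H B')} (Neg (Neg (decidable B')))"
    using DNSV by (intro axiom) (auto simp: DNSV_def decidable_def)
  ultimately have "proves T {Neg B, AllS (?H B')} Bot"
    by (metis ImpE)
  then have "proves T {AllS (?H B')} (Neg (Neg B))"
    by (rule ImpI)
  moreover have "proves T {AllS (?H B')} (Imp (Neg (Neg B)) B)"
    using MP \<open>sigma B\<close> by (intro axiom) (auto simp: MP_def)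
  ultimately have "proves T {AllS (?H B')} B"
    by (metis ImpE)
  \<comment> \<open>Generalizing over \<open>n\<close> undoes the parameter shift in the hypothesis,
    so \<open>B'\<close> there becomes \<open>B\<close> again.\<close>
  then have "proves T {AllS (?H B)} (All B)"
    by (intro AllI) (simp only: lift_H image_insert image_empty)
  then show ?thesis
    unfolding EnDec_for_def by (intro ImpI) simp
qed

theorem theorem2:
  "\<forall>A \<in> EnDec. proves (arithmetic \<union> DNSV \<union> MP) {} A"
  unfolding EnDec_def by (auto intro!: proves_EnDec_for)

end
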